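(* Let $\mathcal A_1,\ldots,\mathcal A_T$ be the sets selected online by the algorithm RAM, and let $(\mathcal B_1^\star,\ldots,\mathcal B_T^\star)$ be an optimal (worst-case) removal from $(\mathcal A_1,\ldots,\mathcal A_T)$. Then $|\mathcal A_t|\le\alpha_t$ for all $t=1,\ldots,T$, and the following hold. (i) If $f$ is submodular, with curvature $\kappa_f$, then $$\frac{f(\mathcal A_1\setminus\mathcal B_1^\star,\ldots,\mathcal A_T\setminus\mathcal B_T^\star)}{f^\star}\ \ge\ \begin{cases}\dfrac{1-e^{-\kappa_f}}{\kappa_f}\,(1-\kappa_f), & T=1,\\[2mm] (1-\kappa_f)^4, & T>1.\end{cases}$$ (ii) If $f$ is $c_f$-submodular (i.e. $f$ is monotone with total curvature $c_f$), then $$\frac{f(\mathcal A_1\setminus\mathcal B_1^\star,\ldots,\mathcal A_T\setminus\mathcal B_T^\star)}{f^\star}\ \ge\ \begin{cases}(1-c_f)^3, & T=1,\\ (1-c_f)^5, & T>1.\end{cases}$$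
   Context: **Setting.** $T\ge 1$ is an integer; $\mathcal V_1,\ldots,\mathcal V_T$ are finite, pairwise disjoint sets; $\mathcal V=\bigcup_{t=1}^T\mathcal V_t$; $f:2^{\mathcal V}\to\mathbb R$ is non-decreasing with $f(\emptyset)=0$; $\alpha_t,\beta_t$ are integers with $0\le\beta_t\le\alpha_t\le|\mathcal V_t|$, $t=1,\ldots,T$. For $\mathcal X_s\subseteq\mathcal V_s$, $f(\mathcal X_1,\ldots,\mathcal X_t)$ denotes $f(\mathcal X_1\cup\cdots\cup\mathcal X_t)$, and $f(v)=f(\{v\})$. **Problem RSM.** $f^\star$ is the optimal value of $$\max_{\mathcal A_1\subseteq\mathcal V_1}\min_{\mathcal B_1\subseteq\mathcal A_1}\cdots\max_{\mathcal A_T\subseteq\mathcal V_T}\min_{\mathcal B_T\subseteq\mathcal A_T} f(\mathcal A_1\setminus\mathcal B_1,\ldots,\mathcal A_T\setminus\mathcal B_T)\quad\text{s.t. } |\mathcal A_t|=\alpha_t,\ |\mathcal B_t|\le\beta_t,\ t=1,\ldots,T.$$ **Algorithm RAM.** At each $t=1,\ldots,T$, having observed the removals $\mathcal B_s\subseteq\mathcal A_s$, $|\mathcal B_s|\le\beta_s$, for $s\le t-1$: (1) sort $\mathcal V_t=\{v_{t,1},\ldots,v_{t,|\mathcal V_t|}\}$ so that $f(v_{t,1})\ge\cdots\ge f(v_{t,|\mathcal V_t|})$ and set $\mathcal S_{t,1}=\{v_{t,1},\ldots,v_{t,\beta_t}\}$; (2) start from $\mathcal S_{t,2}=\emptyset$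 and, while $|\mathcal S_{t,2}|<\alpha_t-\beta_t$, add to $\mathcal S_{t,2}$ an element $x\in\arg\max_{y\in\mathcal V_t\setminus(\mathcal S_{t,1}\cup\mathcal S_{t,2})} f(\mathcal A_1\setminus\mathcal B_1,\ldots,\mathcal A_{t-1}\setminus\mathcal B_{t-1},\mathcal S_{t,2}\cup\{y\})$; (3) output $\mathcal A_t=\mathcal S_{t,1}\cup\mathcal S_{t,2}$. **Optimal removal.** $(\mathcal B_1^\star,\ldots,\mathcal B_T^\star)$ is a sequence of removals, with $\mathcal B_t^\star\subseteq\mathcal A_t$ and $|\mathcal B_t^\star|\le\beta_t$, minimizing the final value $f(\mathcal A_1\setminus\mathcal B_1,\ldots,\mathcal A_T\setminus\mathcal B_T)$, where each $\mathcal A_t$ is RAM's output given the preceding removals. **Submodularity.** $f$ is submodular if $f(\mathcal A\cup\{v\})-f(\mathcal A)\ge f(\mathcal B\cup\{v\})-f(\mathcal B)$ for all $\mathcal A\subseteq\mathcal B\subseteq\mathcal V$ and $v\in\mathcal V$. **Curvature.** For non-decreasing submodular $f$ with $f(v)\ne0$ for all $v\in\mathcal V$ (assumed whenever $\kappa_f$ is used), $\kappa_f=1-\min_{v\in\mathcal V}\frac{f(\mathcal V)-f(\mathcal V\setminus\{v\})}{f(v)}\in[0,1]$. The quantity $(1-e^{-\kappa_f})/\kappa_f$ is read as its limit $1$ when $\kappa_f=0$. **Total curvature.** For monotone (non-decreasing) $f$, $c_f=1-\min_{v\in\mathcal V}\min_{\mathcal A,\mathcal B\subseteq\mathcal V\setminus\{v\}}\frac{f(\{v\}\cup\mathcal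 A)-f(\mathcal A)}{f(\{v\}\cup\mathcal B)-f(\mathcal B)}\in[0,1]$ (equivalently, the smallest $c\in[0,1]$ such that $f(\{v\}\cup\mathcal A)-f(\mathcal A)\ge(1-c)[f(\{v\}\cup\mathcal B)-f(\mathcal B)]$ for all $v$ and all $\mathcal A,\mathcal B\subseteq\mathcal V\setminus\{v\}$). Any monotone $f$ with total curvature $c_f$ is called $c_f$-submodular. Ratios with denominator $f^\star$ are understood for $f^\star>0$. *)

theory Defs
  imports Complex_Main "HOL-Library.Disjoint_Sets"
begin

definition nondecreasing_on :: "'a set \<Rightarrow> ('a set \<Rightarrow> real) \<Rightarrow> bool" where
  "nondecreasing_on U f \<longleftrightarrow> (\<forall>A B. A \<subseteq> B \<and> B \<subseteq> U \<longrightarrow> f A \<le> f B)"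

definition submodular_on :: "'a set \<Rightarrow> ('a set \<Rightarrow> real) \<Rightarrow> bool" where
  "submodular_on U f \<longleftrightarrow>
     (\<forall>A B v. A \<subseteq> B \<and> B \<subseteq> U \<and> v \<in> U \<longrightarrow> f (A \<union> {v}) - f A \<ge> f (B \<union> {v}) - f B)"

definition curvature :: "'a set \<Rightarrow> ('a set \<Rightarrow> real) \<Rightarrow> real" where
  "curvature U f = 1 - Min ((\<lambda>v. (f U - f (U - {v})) / f {v}) ` U)"

text \<open>Ratios with zero denominator are left out of the minimum: for a nondecreasing function they
  impose no condition (see \<open>total_curvature_least\<close>), whereas the HOL convention \<open>x / 0 = 0\<close> would
  turn them into the value 0. The set of ratios is nonempty unless \<open>f\<close> is constant.\<close>

definition total_curvature :: "'a set \<Rightarrow> ('a set \<Rightarrow> real) \<Rightarrow> real" where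
  "total_curvature U f =
     1 - Min {(f ({v} \<union> A) - f A) / (f ({v} \<union> B) - f B) | v A B.
                v \<in> U \<and> A \<subseteq> U - {v} \<and> B \<subseteq> U - {v} \<and> f ({v} \<union> B) - f B \<noteq> 0}"

lemma total_curvature_least:
  assumes fin: "finite U" and mono: "nondecreasing_on U f"
    and w: "w \<in> U" "W \<subseteq> U - {w}" "f ({w} \<union> W) \<noteq> f W"
  defines "P \<equiv> \<lambda>c. 0 \<le> c \<and> c \<le> 1 \<and>
     (\<forall>v\<in>U. \<forall>A B. A \<subseteq> U - {v} \<and> B \<subseteq> U - {v} \<longrightarrow>
        f ({v} \<union> A) - f A \<ge> (1 - c) * (f ({v} \<union> B) - f B))"
  shows "P (total_curvature U f)" and "P c \<Longrightarrow> total_curvature U f \<le> c"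
proof -
  define R where "R = {(f ({v} \<union> A) - f A) / (f ({v} \<union> B) - f B) | v A B.
                v \<in> U \<and> A \<subseteq> U - {v} \<and> B \<subseteq> U - {v} \<and> f ({v} \<union> B) - f B \<noteq> 0}"
  have tc: "total_curvature U f = 1 - Min R"
    by (simp add: total_curvature_def R_def)
  have "R \<subseteq> (\<lambda>(v, A, B). (f ({v} \<union> A) - f A) / (f ({v} \<union> B) - f B)) ` (U \<times> Pow U \<times> Pow U)"
    unfolding R_def by force
  then have finR: "finite R"
    by (rule finite_subset) (use fin in auto)
  have "(f ({w} \<union> W) - f W) / (f ({w} \<union> W) - f W) \<in> R"
    unfolding R_def using w by force
  then have one: "1 \<in> R" using w(3) by simp
  have ge0: "f ({v} \<union> A) - f A \<ge> 0" if "v \<in> U" "A \<subseteq> U - {v}" for v A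
    using mono that unfolding nondecreasing_on_def
    by (metis diff_ge_0_iff_ge Diff_subset Un_least Un_upper2 empty_subsetI insert_subset order_trans)
  have "\<forall>r\<in>R. r \<ge> 0"
    unfolding R_def using ge0 by (auto intro!: divide_nonneg_nonneg)
  moreover have inR: "Min R \<in> R" using finR one by (auto intro: Min_in)
  ultimately have m0: "Min R \<ge> 0" by blast
  have m1: "Min R \<le> 1" using finR one by simp
  have main: "f ({v} \<union> A) - f A \<ge> Min R * (f ({v} \<union> B) - f B)"
    if v: "v \<in> U" "A \<subseteq> U - {v}" "B \<subseteq> U - {v}" for v A B
  proof (cases "f ({v} \<union> B) - f B = 0")
    case True
    then show ?thesis using ge0[OF v(1,2)] by simp
  next
    case False
    then have "(f ({v} \<union> A) - f A) / (f ({v} \<union> B) - f B) \<in> R"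
      unfolding R_def using v by blast
    then have "Min R \<le> (f ({v} \<union> A) - f A) / (f ({v} \<union> B) - f B)"
      using finR by simp
    moreover have "f ({v} \<union> B) - f B > 0" using False ge0[OF v(1,3)] by simp
    ultimately show ?thesis by (simp only: pos_le_divide_eq)
  qed
  show "P (total_curvature U f)"
    unfolding P_def tc using m0 m1 main by simp
  show "total_curvature U f \<le> c" if "P c"
  proof -
    obtain v A B where *: "Min R = (f ({v} \<union> A) - f A) / (f ({v} \<union> B) - f B)"
      "v \<in> U" "A \<subseteq> U - {v}" "B \<subseteq> U - {v}" "f ({v} \<union> B) - f B \<noteq> 0"
      using inR unfolding R_def by blast
    have "f ({v} \<union> B) - f B > 0" using *(5) ge0[OF *(2,4)] by simp
    moreover have "f ({v} \<union> A) - f A \<ge> (1 - c) * (f ({v} \<union> B) - f B)"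
      using that * unfolding P_def by blast
    ultimately have "1 - c \<le> Min R" unfolding *(1) by (simp only: pos_le_divide_eq)
    then show ?thesis unfolding tc by simp
  qed
qed

text \<open>\<open>rsm_value f V \<alpha> \<beta> n t K\<close> is the value of the \<open>n\<close> remaining max-min stages
  \<open>t, ..., t + n - 1\<close>, where \<open>K\<close> is the union of the sets kept at the stages before \<open>t\<close>.\<close>

primrec rsm_value ::
  "('a set \<Rightarrow> real) \<Rightarrow> (nat \<Rightarrow> 'a set) \<Rightarrow> (nat \<Rightarrow> nat) \<Rightarrow> (nat \<Rightarrow> nat) \<Rightarrow> nat \<Rightarrow> nat \<Rightarrow> 'a set \<Rightarrow> real" where
  "rsm_value f V \<alpha> \<beta> 0 t K = f K"
| "rsm_value f V \<alpha> \<beta> (Suc n) t K =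
     Max ((\<lambda>A. Min ((\<lambda>B. rsm_value f V \<alpha> \<beta> n (Suc t) (K \<union> (A - B)))
                      ` {B. B \<subseteq> A \<and> card B \<le> \<beta> t}))
            ` {A. A \<subseteq> V t \<and> card A = \<alpha> t})"

definition rsm_optimum ::
  "nat \<Rightarrow> (nat \<Rightarrow> 'a set) \<Rightarrow> ('a set \<Rightarrow> real) \<Rightarrow> (nat \<Rightarrow> nat) \<Rightarrow> (nat \<Rightarrow> nat) \<Rightarrow> real" where
  "rsm_optimum T V f \<alpha> \<beta> = rsm_value f V \<alpha> \<beta> T 1 {}"

text \<open>The reachable states of the greedy loop, with arbitrary choices among ties.\<close>

inductive greedy_state ::
  "('a set \<Rightarrow> real) \<Rightarrow> 'a set \<Rightarrow> 'a set \<Rightarrow> 'a set \<Rightarrow> nat \<Rightarrow> 'a set \<Rightarrow> bool"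
  for f K Vt S1 m where
  init: "greedy_state f K Vt S1 m {}"
| step: "\<lbrakk>greedy_state f K Vt S1 m S2; card S2 < m;
          is_arg_max (\<lambda>y. f (K \<union> (S2 \<union> {y}))) (\<lambda>y. y \<in> Vt - (S1 \<union> S2)) x\<rbrakk>
         \<Longrightarrow> greedy_state f K Vt S1 m (S2 \<union> {x})"

text \<open>\<open>A\<close> is a possible output of one RAM step on \<open>Vt\<close> with bounds \<open>a\<close> and \<open>b\<close>, where \<open>K\<close> is
  the union of the sets kept so far; the list \<open>vs\<close> is the sorting of \<open>Vt\<close>.\<close>

definition ram_output ::
  "('a set \<Rightarrow> real) \<Rightarrow> 'a set \<Rightarrow> nat \<Rightarrow> nat \<Rightarrow> 'a set \<Rightarrow> 'a set \<Rightarrow> bool" where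
  "ram_output f Vt a b K A \<longleftrightarrow>
     (\<exists>vs S1 S2. distinct vs \<and> set vs = Vt \<and> sorted_wrt (\<lambda>x y. f {x} \<ge> f {y}) vs \<and>
        S1 = set (take b vs) \<and>
        greedy_state f K Vt S1 (a - b) S2 \<and> \<not> card S2 < a - b \<and>
        A = S1 \<union> S2)"

text \<open>An online selection rule \<open>\<sigma>\<close> maps the list of observed removals
  \<open>[B 1, ..., B (t - 1)]\<close> to the set selected at time \<open>t\<close>.\<close>

definition selected :: "('a set list \<Rightarrow> 'a set) \<Rightarrow> (nat \<Rightarrow> 'a set) \<Rightarrow> nat \<Rightarrow> 'a set" where
  "selected \<sigma> B t = \<sigma> (map B [1..<t])"

definition kept :: "('a set list \<Rightarrow> 'a set) \<Rightarrow> (nat \<Rightarrow> 'a set) \<Rightarrow> nat \<Rightarrow> 'a set" where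
  "kept \<sigma> B t = (\<Union>s\<in>{1..t}. selected \<sigma> B s - B s)"

definition removal ::
  "nat \<Rightarrow> (nat \<Rightarrow> nat) \<Rightarrow> ('a set list \<Rightarrow> 'a set) \<Rightarrow> (nat \<Rightarrow> 'a set) \<Rightarrow> bool" where
  "removal t \<beta> \<sigma> B \<longleftrightarrow> (\<forall>s\<in>{1..t}. B s \<subseteq> selected \<sigma> B s \<and> card (B s) \<le> \<beta> s)"

text \<open>\<open>\<sigma>\<close> is an execution of RAM: some resolution of all ties (possibly dependent on the observed
  removals), for every admissible sequence of removals.\<close>

definition ram_rule ::
  "nat \<Rightarrow> (nat \<Rightarrow> 'a set) \<Rightarrow> ('a set \<Rightarrow> real) \<Rightarrow> (nat \<Rightarrow> nat) \<Rightarrow> (nat \<Rightarrow> nat) \<Rightarrow>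
   ('a set list \<Rightarrow> 'a set) \<Rightarrow> bool" where
  "ram_rule T V f \<alpha> \<beta> \<sigma> \<longleftrightarrow>
     (\<forall>t\<in>{1..T}. \<forall>B. removal (t - 1) \<beta> \<sigma> B \<longrightarrow>
        ram_output f (V t) (\<alpha> t) (\<beta> t) (kept \<sigma> B (t - 1)) (selected \<sigma> B t))"

definition optimal_removal ::
  "nat \<Rightarrow> ('a set \<Rightarrow> real) \<Rightarrow> (nat \<Rightarrow> nat) \<Rightarrow> ('a set list \<Rightarrow> 'a set) \<Rightarrow> (nat \<Rightarrow> 'a set) \<Rightarrow> bool" where
  "optimal_removal T f \<beta> \<sigma> B \<longleftrightarrow> is_arg_min (\<lambda>B. f (kept \<sigma> B T)) (removal T \<beta> \<sigma>) B"

end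

theory Submission
  imports Defs
begin

text \<open>Write \<open>q\<close> for \<open>1 - \<kappa>\<close> or \<open>1 - c\<close>: any marginal of an element is at least \<open>q\<close> times any
  other marginal of that element. Against RAM's singleton part \<open>S1 t\<close>, the adversary can force every
  other strategy to keep exactly \<open>\<alpha> t - \<beta> t\<close> elements outside \<open>S1 t\<close>, which bounds \<open>fstar\<close> by
  the value of such a family \<open>P\<close>. Step by step, the kept set gains at least \<open>q\<close> times the sum of its
  singleton values; that sum dominates the one over \<open>S2 t\<close>, because every removed element of
  \<open>S2 t\<close> leaves an unremoved element of \<open>S1 t\<close> of no smaller value; this loses another factor \<open>q\<close>
  against the gain of \<open>S2 t\<close>, and the greedy choice of \<open>S2 t\<close> loses a third \<open>q\<close> against \<open>P t\<close>.
  So \<open>q ^ 3\<close> holds throughout. For submodular \<open>f\<close> and \<open>T = 1\<close> the last two losses are replaced by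
  subadditivity and the Conforti-Cornuejols bound for the greedy algorithm.\<close>

section \<open>Marginal ratios obtained from the two curvatures\<close>

text \<open>One interface for both curvatures. The product form covers vanishing marginals, and
  \<open>A\<close> and \<open>B\<close> need not be nested, so marginals can be moved between
  unrelated contexts.\<close>

definition marginal_ratio :: "'a set \<Rightarrow> ('a set \<Rightarrow> real) \<Rightarrow> real \<Rightarrow> bool" where
  "marginal_ratio U f q \<longleftrightarrow>
     (\<forall>v\<in>U. \<forall>A B. A \<subseteq> U - {v} \<and> B \<subseteq> U - {v} \<longrightarrow>
        q * (f (insert v B) - f B) \<le> f (insert v A) - f A)"

lemma marginal_ratioD:
  "marginal_ratio U f q \<Longrightarrow> v \<in> U \<Longrightarrow> A \<subseteq> U \<Longrightarrow> v \<notin> A \<Longrightarrow> B \<subseteq> U \<Longrightarrow> v \<notin> B \<Longrightarrow>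
   q * (f (insert v B) - f B) \<le> f (insert v A) - f A"
  unfolding marginal_ratio_def by (metis subset_Diff_insert Diff_empty)

lemma nondecreasing_onD: "nondecreasing_on U f \<Longrightarrow> A \<subseteq> B \<Longrightarrow> B \<subseteq> U \<Longrightarrow> f A \<le> f B"
  unfolding nondecreasing_on_def by blast

text \<open>The \<open>Min\<close> in \<open>total_curvature\<close> needs a nonzero marginal. If
  there were none, building \<open>A\<close> up element by element would give
  \<open>f A = f {}\<close>.\<close>

lemma marginal_ratio_total_curvature:
  assumes "finite U" "nondecreasing_on U f" "A \<subseteq> U" "f A \<noteq> f {}"
  shows "marginal_ratio U f (1 - total_curvature U f)"
    and "0 \<le> total_curvature U f" and "total_curvature U f \<le> 1"
proof -
  have "\<exists>w W. w \<in> U \<and> W \<subseteq> U - {w} \<and> f ({w} \<union> W) \<noteq> f W"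
  proof (rule ccontr)
    assume no: "\<nexists>w W. w \<in> U \<and> W \<subseteq> U - {w} \<and> f ({w} \<union> W) \<noteq> f W"
    have "finite A" using assms finite_subset by blast
    then have "f A = f {}" using \<open>A \<subseteq> U\<close>
    proof (induction A)
      case (insert x F)
      then have "f ({x} \<union> F) = f F" using no by (metis insert_subset subset_Diff_insert Diff_empty)
      then show ?case using insert by simp
    qed simp
    then show False using assms by simp
  qed
  then obtain w W where w: "w \<in> U" "W \<subseteq> U - {w}" "f ({w} \<union> W) \<noteq> f W" by blast
  show "marginal_ratio U f (1 - total_curvature U f)"
    and "0 \<le> total_curvature U f" and "total_curvature U f \<le> 1"
    using total_curvature_least(1)[OF assms(1,2) w] by (auto simp: marginal_ratio_def)
qed

lemma submodular_onD:
  "submodular_on U f \<Longrightarrow> A \<subseteq> B \<Longrightarrow> B \<subseteq> U \<Longrightarrow> v \<in> U \<Longrightarrow> f (insert v B) - f B \<le> f (insert v A) - f A"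
  unfolding submodular_on_def by (metis Un_insert_right sup_bot_right)

text \<open>By submodularity every marginal of \<open>v\<close> lies between the one on
  \<open>U - {v}\<close> and \<open>f {v}\<close>, and \<open>curvature\<close> compares exactly
  these two extremes.\<close>

lemma marginal_ratio_curvature:
  assumes fin: "finite U" and "U \<noteq> {}" and mono: "nondecreasing_on U f" and f0: "f {} = 0"
    and sub: "submodular_on U f" and nz: "\<forall>v\<in>U. f {v} \<noteq> 0"
  shows "marginal_ratio U f (1 - curvature U f)"
    and "0 \<le> curvature U f" and "curvature U f \<le> 1"
proof -
  define R where "R = (\<lambda>v. (f U - f (U - {v})) / f {v}) ` U"
  have R: "finite R" "R \<noteq> {}" using assms by (auto simp: R_def)
  have q: "1 - curvature U f = Min R" by (simp add: curvature_def R_def)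
  have pos: "f {v} > 0" if "v \<in> U" for v
    using nondecreasing_onD[OF mono, of "{}" "{v}"] that nz f0 by force
  have last: "f U - f (U - {v}) \<le> f {v}" "0 \<le> f U - f (U - {v})" if "v \<in> U" for v
    using submodular_onD[OF sub, of "{}" "U - {v}" v] nondecreasing_onD[OF mono, of "U - {v}" U] that f0
    by (auto simp: insert_absorb)
  have range: "0 \<le> r \<and> r \<le> 1" if "r \<in> R" for r
    using that last pos by (force simp: R_def)
  have "Min R \<in> R" using R by (rule Min_in)
  from range[OF this] show "0 \<le> curvature U f" "curvature U f \<le> 1" using q by auto
  show "marginal_ratio U f (1 - curvature U f)"
    unfolding marginal_ratio_def q
  proof (intro ballI allI impI)
    fix v A B assume v: "v \<in> U" and AB: "A \<subseteq> U - {v} \<and> B \<subseteq> U - {v}"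
    have "Min R * (f (insert v B) - f B) \<le> Min R * f {v}"
      using submodular_onD[OF sub, of "{}" B v] AB v f0 range[OF \<open>Min R \<in> R\<close>]
      by (intro mult_left_mono) auto
    also have "\<dots> \<le> (f U - f (U - {v})) / f {v} * f {v}"
      using v R pos[OF v] by (intro mult_right_mono Min_le) (auto simp: R_def)
    also have "\<dots> = f (insert v (U - {v})) - f (U - {v})" using nz v by (simp add: insert_absorb)
    also have "\<dots> \<le> f (insert v A) - f A" using AB v by (intro submodular_onD[OF sub]) auto
    finally show "Min R * (f (insert v B) - f B) \<le> f (insert v A) - f A" .
  qed
qed

text \<open>The elements of \<open>W\<close> are added one at a time, and each marginal is compared
  in both directions with the marginal over \<open>{}\<close>. Disjointness makes every added
  element new.\<close>

lemma marginal_sum_bounds: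
  assumes ratio: "marginal_ratio U f q" and f0: "f {} = 0" and "finite W" "W \<subseteq> U" "K \<subseteq> U" "W \<inter> K = {}"
  shows "q * (\<Sum>v\<in>W. f {v}) \<le> f (K \<union> W) - f K"
    and "q * (f (K \<union> W) - f K) \<le> (\<Sum>v\<in>W. f {v})"
proof -
  have "q * (\<Sum>v\<in>W. f {v}) \<le> f (K \<union> W) - f K \<and> q * (f (K \<union> W) - f K) \<le> (\<Sum>v\<in>W. f {v})"
    using assms(3-)
  proof (induction W)
    case (insert x F)
    have "q * (f {x}) \<le> f (insert x (K \<union> F)) - f (K \<union> F)"
      using marginal_ratioD[OF ratio, of x "K \<union> F" "{}"] insert f0 by auto
    moreover have "q * (f (insert x (K \<union> F)) - f (K \<union> F)) \<le> f {x}"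
      using marginal_ratioD[OF ratio, of x "{}" "K \<union> F"] insert f0 by auto
    moreover note insert
    ultimately show ?case by (auto simp: algebra_simps)
  qed simp
  then show "q * (\<Sum>v\<in>W. f {v}) \<le> f (K \<union> W) - f K"
    and "q * (f (K \<union> W) - f K) \<le> (\<Sum>v\<in>W. f {v})" by blast+
qed

text \<open>Overlap of \<open>W\<close> and \<open>K\<close> is allowed: common elements contribute
  0.\<close>

lemma submodular_marginal_le_sum:
  assumes sub: "submodular_on U f" and "finite W" "W \<subseteq> U" "K \<subseteq> U"
  shows "f (K \<union> W) - f K \<le> (\<Sum>v\<in>W. f (insert v K) - f K)"
  using assms(2-)
proof (induction W)
  case (insert x F)
  then have "f (insert x (K \<union> F)) - f (K \<union> F) \<le> f (insert x K) - f K"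
    by (intro submodular_onD[OF sub]) auto
  then show ?case using insert by auto
qed simp

section \<open>One RAM step: greedy choice and removals\<close>

lemma greedy_state_subset:
  assumes "greedy_state f K Vt S1 m S2"
  shows "finite S2 \<and> S2 \<subseteq> Vt - S1 \<and> card S2 \<le> m"
  using assms by induction (auto simp: is_arg_max_def card_insert_if)

lemma ram_outputE:
  assumes out: "ram_output f Vt a b K A" and "b \<le> a" "a \<le> card Vt"
  obtains S1 S2 where "A = S1 \<union> S2" "S1 \<subseteq> Vt" "card S1 = b" "S2 \<subseteq> Vt - S1" "card S2 = a - b"
    "greedy_state f K Vt S1 (a - b) S2" "\<And>v w. v \<in> S1 \<Longrightarrow> w \<in> Vt - S1 \<Longrightarrow> f {w} \<le> f {v}"
proof -
  from out obtain vs S1 S2 where vs: "distinct vs" "set vs = Vt" "sorted_wrt (\<lambda>x y. f {x} \<ge> f {y}) vs"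
    and S: "S1 = set (take b vs)" "greedy_state f K Vt S1 (a - b) S2" "\<not> card S2 < a - b" "A = S1 \<union> S2"
    unfolding ram_output_def by blast
  have "length vs = card Vt" using vs distinct_card by fastforce
  then have "card S1 = b" using assms vs(1) S(1) by (simp add: distinct_card)
  moreover have "f {w} \<le> f {v}" if "v \<in> S1" "w \<in> Vt - S1" for v w
  proof -
    have "Vt = set (take b vs) \<union> set (drop b vs)" using vs(2) by (metis append_take_drop_id set_append)
    then have "w \<in> set (drop b vs)" using that S(1) by blast
    moreover have "sorted_wrt (\<lambda>x y. f {x} \<ge> f {y}) (take b vs @ drop b vs)" using vs(3) by simp
    ultimately show ?thesis using that S(1) unfolding sorted_wrt_append by blast
  qed
  moreover have "S1 \<subseteq> Vt" using S(1) vs(2) by (auto dest: in_set_takeD)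
  ultimately show ?thesis
    using that S greedy_state_subset[OF S(2)] by force
qed

text \<open>In each round some \<open>p\<close> in \<open>P\<close> is still unchosen, by
  cardinality. The greedy gain is at least that of \<open>p\<close>, which is at least
  \<open>q\<close> times the marginal of \<open>p\<close> over the rest of \<open>P\<close>; the
  induction continues with \<open>P - {p}\<close>. The contexts \<open>K\<close> and
  \<open>X\<close> may differ, as they do when stages are chained.\<close>

lemma greedy_marginal_ratio:
  assumes "greedy_state f K Vt S1 m S2" and ratio: "marginal_ratio U f q"
    and "Vt \<subseteq> U" "K \<subseteq> U - Vt" "X \<subseteq> U - Vt"
    and "finite P" "P \<subseteq> Vt - S1" "card P = card S2"
  shows "q * (f (X \<union> P) - f X) \<le> f (K \<union> S2) - f K"
  using assms(1,6-)
proof (induction arbitrary: P)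
  case init
  then show ?case by simp
next
  case (step S2 x)
  note g = greedy_state_subset[OF step.hyps(1)]
  have x: "x \<in> Vt - (S1 \<union> S2)" using step.hyps(3) by (auto simp: is_arg_max_def)
  then have cP: "card P = Suc (card S2)" using step.prems(3) g by simp
  obtain p where p: "p \<in> P" "p \<notin> S2"
    using cP g by (metis card_mono Suc_n_not_le_n subsetI)
  have p': "p \<in> U" "p \<in> Vt" "p \<notin> S1" using p step.prems assms(3) by auto
  have "q * (f (X \<union> (P - {p})) - f X) \<le> f (K \<union> S2) - f K"
    using step.prems p cP by (intro step.IH) auto
  moreover have "q * (f (insert p (X \<union> (P - {p}))) - f (X \<union> (P - {p}))) \<le> f (insert p (K \<union> S2)) - f (K \<union> S2)"
    using p p' assms(3-5) step.prems(2) g by (intro marginal_ratioD[OF ratio]) auto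
  moreover have "insert p (X \<union> (P - {p})) = X \<union> P" using p by auto
  moreover have "f (K \<union> (S2 \<union> {p})) \<le> f (K \<union> (S2 \<union> {x}))"
    using step.hyps(3) p p' unfolding is_arg_max_def by (metis DiffI UnE not_less)
  ultimately show ?case by (simp add: algebra_simps)
qed

text \<open>As \<open>card B \<le> card S1\<close>, \<open>B\<close> takes no more from
  \<open>S2\<close> than it leaves in \<open>S1\<close>. An injection \<open>h\<close> charges each
  lost element to a survivor dominating it; nonnegativity handles survivors outside the range of
  \<open>h\<close>.\<close>

lemma sum_singletons_after_removal:
  fixes g :: "'a \<Rightarrow> real"
  assumes "finite S1" "finite S2" "S1 \<inter> S2 = {}" "card B \<le> card S1" "finite B"
    and dom: "\<And>v w. v \<in> S1 \<Longrightarrow> w \<in> S2 \<Longrightarrow> g w \<le> g v" and nonneg: "\<And>v. v \<in> S1 \<Longrightarrow> 0 \<le> g v"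
  shows "sum g S2 \<le> sum g (S1 \<union> S2 - B)"
proof -
  have "card (S1 \<inter> B) + card (S2 \<inter> B) \<le> card B"
    using assms by (subst card_Un_disjoint[symmetric]) (auto intro!: card_mono)
  moreover have "card (S1 - B) + card (S1 \<inter> B) = card S1"
    using assms by (subst card_Un_disjoint[symmetric]) (auto intro: arg_cong[where f = card])
  ultimately have "card (S2 \<inter> B) \<le> card (S1 - B)" using assms by linarith
  then obtain h where h: "inj_on h (S2 \<inter> B)" "h ` (S2 \<inter> B) \<subseteq> S1 - B"
    using card_le_inj[of "S2 \<inter> B" "S1 - B"] assms by auto
  have "sum g S2 = sum g (S2 \<inter> B) + sum g (S2 - B)"
    using assms by (simp add: sum.Int_Diff)
  also have "sum g (S2 \<inter> B) \<le> sum (g \<circ> h) (S2 \<inter> B)"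
    using h dom by (auto intro!: sum_mono)
  also have "\<dots> = sum g (h ` (S2 \<inter> B))" using h by (simp add: sum.reindex)
  also have "\<dots> \<le> sum g (S1 - B)" using h assms by (intro sum_mono2) auto
  also have "sum g (S1 - B) + sum g (S2 - B) = sum g (S1 \<union> S2 - B)"
    using assms by (subst sum.union_disjoint[symmetric]) (auto intro!: sum.cong)
  finally show ?thesis by simp
qed

section \<open>Upper bound on the optimum\<close>

text \<open>The adversary removes all of \<open>C s\<close> that was selected and then arbitrary further elements.\<close>

lemma rsm_value_upper_bound:
  assumes "\<And>s. s \<in> {t..<t + n} \<Longrightarrow>
    finite (V s) \<and> finite (C s) \<and> card (C s) \<le> \<beta> s \<and> \<beta> s \<le> \<alpha> s \<and> \<alpha> s \<le> card (V s)"
  shows "\<exists>P. (\<forall>s\<in>{t..<t + n}. P s \<subseteq> V s - C s \<and> card (P s) = \<alpha> s - \<beta> s) \<and>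
    rsm_value f V \<alpha> \<beta> n t K \<le> f (K \<union> (\<Union>s\<in>{t..<t + n}. P s))"
  using assms
proof (induction n arbitrary: t K)
  case 0
  then show ?case by simp
next
  case (Suc n)
  define val where "val = (\<lambda>A B. rsm_value f V \<alpha> \<beta> n (Suc t) (K \<union> (A - B)))"
  define inner where "inner = (\<lambda>A. Min (val A ` {B. B \<subseteq> A \<and> card B \<le> \<beta> t}))"
  have t: "finite (V t)" "finite (C t)" "card (C t) \<le> \<beta> t" "\<beta> t \<le> \<alpha> t" "\<alpha> t \<le> card (V t)"
    using Suc.prems[of t] by auto
  have "finite {A. A \<subseteq> V t \<and> card A = \<alpha> t}" using t by simp
  moreover have "{A. A \<subseteq> V t \<and> card A = \<alpha> t} \<noteq> {}" using obtain_subset_with_card_n[OF t(5)] by blast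
  ultimately have "Max (inner ` {A. A \<subseteq> V t \<and> card A = \<alpha> t}) \<in> inner ` {A. A \<subseteq> V t \<and> card A = \<alpha> t}"
    by (intro Max_in) auto
  then obtain A where A: "A \<subseteq> V t" "card A = \<alpha> t"
    and max: "Max (inner ` {A. A \<subseteq> V t \<and> card A = \<alpha> t}) = inner A"
    by blast
  have finA: "finite A" using A t finite_subset by blast
  have "card (A \<inter> C t) \<le> \<beta> t" using t by (meson card_mono inf_le2 order_trans)
  then obtain B where B: "A \<inter> C t \<subseteq> B" "B \<subseteq> A" "card B = \<beta> t"
    using exists_subset_between[of "A \<inter> C t" "\<beta> t" A] A t finA by auto
  have "inner A \<le> val A B"
    unfolding inner_def using B finA by (intro Min_le) auto
  also obtain P where P: "\<forall>s\<in>{Suc t..<Suc t + n}. P s \<subseteq> V s - C s \<and> card (P s) = \<alpha> s - \<beta> s"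
    and "val A B \<le> f (K \<union> (A - B) \<union> (\<Union>s\<in>{Suc t..<Suc t + n}. P s))"
    unfolding val_def using Suc.IH[of "Suc t" "K \<union> (A - B)"] Suc.prems by auto
  note this(2)
  \<comment> \<open>The induction hypothesis supplies \<open>P\<close> for the later stages only;
    stage \<open>t\<close> contributes \<open>A - B\<close>.\<close>
  also have "K \<union> (A - B) \<union> (\<Union>s\<in>{Suc t..<Suc t + n}. P s) = K \<union> (\<Union>s\<in>{t..<t + Suc n}. (P(t := A - B)) s)"
  proof -
    have "{t..<t + Suc n} = insert t {Suc t..<Suc t + n}" by auto
    then show ?thesis by auto
  qed
  finally have "rsm_value f V \<alpha> \<beta> (Suc n) t K \<le> f (K \<union> (\<Union>s\<in>{t..<t + Suc n}. (P(t := A - B)) s))"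
    using max by (simp add: inner_def val_def)
  moreover have "card (A - B) = \<alpha> t - \<beta> t" using A B finA by (simp add: card_Diff_subset finite_subset)
  then have "\<forall>s\<in>{t..<t + Suc n}. (P(t := A - B)) s \<subseteq> V s - C s \<and> card ((P(t := A - B)) s) = \<alpha> s - \<beta> s"
    using P A B by auto
  ultimately show ?case by blast
qed

section \<open>Greedy under curvature\<close>

text \<open>After the greedy choices \<open>S\<close>, with \<open>m\<close> rounds to go and \<open>n\<close> elements of the competitor
  \<open>P\<close> not yet chosen, the remaining rounds gain at least \<open>greedy_rate k m n\<close> times
  \<open>f (P \<union> S) - f S\<close>, where \<open>k\<close> is the curvature. The sum is \<open>(1 - (1 - k / n) ^ m) / k\<close>
  without the division by \<open>k\<close>.\<close>

definition greedy_rate :: "real \<Rightarrow> nat \<Rightarrow> nat \<Rightarrow> real" where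
  "greedy_rate k m n = (\<Sum>j<m. (1 - k / real n) ^ j) / real n"

text \<open>Peels off the first term, matching a greedy round followed by \<open>m\<close> remaining
  ones.\<close>

lemma greedy_rate_Suc: "greedy_rate k (Suc m) n = 1 / real n + (1 - k / real n) * greedy_rate k m n"
  unfolding greedy_rate_def sum.lessThan_Suc_shift
  by (simp add: sum_distrib_left add_divide_distrib del: sum.lessThan_Suc)

text \<open>The sum has \<open>m \<le> n\<close> terms in [0,1]. The upper bounds keep the
  coefficients of \<delta> nonnegative in the two cases of the invariant below.\<close>

lemma greedy_rate_bounds:
  assumes "0 \<le> k" "k \<le> 1" "m \<le> n"
  shows "0 \<le> greedy_rate k m n" "greedy_rate k m n \<le> 1" "k * greedy_rate k m n \<le> 1"
proof -
  have b: "0 \<le> 1 - k / real n" "1 - k / real n \<le> 1"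
    using assms by (cases "n = 0"; simp add: field_simps)+
  show 0: "0 \<le> greedy_rate k m n" unfolding greedy_rate_def using b by (auto intro!: divide_nonneg_nonneg sum_nonneg)
  have "(\<Sum>j<m. (1 - k / real n) ^ j) \<le> (\<Sum>j<m. 1)" using b by (intro sum_mono power_le_one)
  also have "\<dots> \<le> real n" using assms by simp
  finally show 1: "greedy_rate k m n \<le> 1" unfolding greedy_rate_def by (cases "n = 0") (auto simp: divide_le_eq_1)
  show "k * greedy_rate k m n \<le> 1" using 0 1 assms by (simp add: mult_le_one)
qed

text \<open>Needed when greedy picks an element of the competitor. It holds termwise, and the extreme term
  says that \<open>(1 - k / N) ^ (N - 1)\<close> decreases in \<open>N\<close>.\<close>

lemma greedy_rate_overlap:
  assumes k: "0 \<le> k" "k \<le> 1" and mn: "m \<le> n"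
  shows "(real (Suc n) - k) * greedy_rate k m (Suc n) \<le> real n * greedy_rate k m n"
proof (cases "n = 0")
  case True
  then show ?thesis using mn by (simp add: greedy_rate_def)
next
  case False
  define a where "a = 1 - k / real n"
  define b where "b = 1 - k / real (Suc n)"
  have b: "0 < b" "b \<le> 1" using k False by (auto simp: b_def field_simps)
  have a: "0 \<le> a" using k False by (auto simp: a_def field_simps)
  \<comment> \<open>Bernoulli's inequality gives
    \<open>b \<le> 1 + j * (a / b - 1) \<le> (a / b) ^ j\<close>; multiply by
    \<open>b ^ j\<close>.\<close>
  have termwise: "b ^ Suc j \<le> a ^ j" if "j < n" for j
  proof -
    have ab: "a / b - 1 = - k / (real n * (real n + 1 - k))"
      using b False k unfolding a_def b_def by (simp add: divide_simps) (simp add: algebra_simps)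
    \<comment> \<open>Up to a factor \<open>k\<close>, this is
      \<open>b \<le> 1 + j * (a / b - 1)\<close> with denominators cleared; it rests on
      \<open>j \<le> n - 1\<close> and \<open>k \<le> 1\<close>.\<close>
    have "real j * (real n + 1) \<le> real n * (real n + 1 - k)"
    proof -
      have "real j * (real n + 1) \<le> (real n - 1) * (real n + 1)"
        using that by (intro mult_right_mono) auto
      also have "\<dots> \<le> real n * real n" by (simp add: algebra_simps)
      also have "\<dots> \<le> real n * (real n + 1 - k)" using k by (intro mult_left_mono) auto
      finally show ?thesis .
    qed
    then have "k * (real j * (real n + 1)) \<le> k * (real n * (real n + 1 - k))"
      using k by (rule_tac mult_left_mono)
    moreover have "real n * (real n + 1 - k) > 0" using False k by auto
    ultimately have "real j * (k / (real n * (real n + 1 - k))) \<le> k / (real n + 1)"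
      by (simp add: divide_simps) (simp add: algebra_simps)
    then have "b \<le> 1 + real j * (a / b - 1)"
      unfolding ab by (simp add: b_def add.commute)
    also have "\<dots> \<le> (1 + (a / b - 1)) ^ j" using a b by (intro Bernoulli_inequality) auto
    finally have "b \<le> a ^ j / b ^ j" by (simp add: power_divide)
    then show ?thesis using b by (simp add: pos_le_divide_eq)
  qed
  have "(real (Suc n) - k) * greedy_rate k m (Suc n) = b * (\<Sum>j<m. b ^ j)"
    by (simp add: greedy_rate_def b_def field_simps)
  also have "\<dots> = (\<Sum>j<m. b ^ Suc j)" by (simp add: sum_distrib_left)
  also have "\<dots> \<le> (\<Sum>j<m. a ^ j)" using mn by (intro sum_mono termwise) auto
  also have "\<dots> = real n * greedy_rate k m n" using False by (simp add: greedy_rate_def a_def)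
  finally show ?thesis .
qed

text \<open>Geometric sum together with \<open>(1 - k / n) ^ n \<le> exp (- k)\<close>; at
  \<open>k = 0\<close> the rate is exactly the limit value 1.\<close>

lemma greedy_rate_ge_exp:
  assumes "0 \<le> k" "k \<le> 1" "n > 0"
  shows "(if k = 0 then 1 else (1 - exp (- k)) / k) \<le> greedy_rate k n n"
proof (cases "k = 0")
  case True
  then show ?thesis using assms by (simp add: greedy_rate_def)
next
  case False
  have "1 - k / real n \<noteq> 1" using False assms by simp
  then have "greedy_rate k n n = (1 - (1 - k / real n) ^ n) / k"
    using False assms unfolding greedy_rate_def by (simp add: sum_gp_strict)
  moreover have "(1 - k / real n) ^ n \<le> exp (- k)"
    using exp_ge_one_minus_x_over_n_power_n[of k n] assms by auto
  ultimately show ?thesis using False assms by (simp add: divide_right_mono)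
qed

text \<open>The right-hand side is a potential: it equals the left-hand side at
  \<open>S = {}\<close>, no greedy step decreases it, and it is \<open>f S\<close> once
  \<open>card S = m\<close>.\<close>

lemma greedy_curvature_invariant:
  assumes "greedy_state f {} Vt S1 m S" and mono: "nondecreasing_on U f" and sub: "submodular_on U f"
    and ratio: "marginal_ratio U f (1 - k)" and k: "0 \<le> k" "k \<le> 1" and f0: "f {} = 0"
    and "Vt \<subseteq> U" and P: "finite P" "P \<subseteq> Vt - S1" "card P = m"
  shows "greedy_rate k m m * f P
    \<le> f S + greedy_rate k (m - card S) (card (P - S)) * (f (P \<union> S) - f S)"
  using assms(1)
proof induction
  case init
  then show ?case using P f0 by simp
next
  case (step S x)
  note g = greedy_state_subset[OF step.hyps(1)]
  have x: "x \<in> Vt - S1" "x \<notin> S" using step.hyps(3) by (auto simp: is_arg_max_def)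
  define \<delta> where "\<delta> = f (insert x S) - f S"
  define D where "D = f (P \<union> S) - f S"
  define D' where "D' = f (P \<union> insert x S) - f (insert x S)"
  define n where "n = card (P - S)"
  obtain m' where m': "m - card S = Suc m'" using step.hyps(2) by (metis Suc_diff_Suc)
  then have m'': "m - card (insert x S) = m'" using x g by simp
  \<comment> \<open>At least as many competitors as rounds remain, as the rate bounds
    require.\<close>
  have "m \<le> n + card S"
    unfolding n_def P(3)[symmetric] using P(1) g
    by (metis card_mono card_Un_le finite_UnI Un_Diff_cancel2 Un_upper1 finite_Diff le_trans)
  then have mn: "Suc m' \<le> n" using m' by linarith
  have sU: "S \<subseteq> U" "P \<subseteq> U" "x \<in> U" using g x P(2) \<open>Vt \<subseteq> U\<close> by auto
  have D0: "D \<ge> 0" unfolding D_def using sU nondecreasing_onD[OF mono, of S "P \<union> S"] by auto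
  have D'0: "D' \<ge> 0" unfolding D'_def using sU nondecreasing_onD[OF mono, of "insert x S" "P \<union> insert x S"] by auto
  \<comment> \<open>\<open>D\<close> is at most the sum of \<open>n\<close> marginals, none above
    the greedy gain \<delta>; hence \<open>D / n \<le> \<delta>\<close>.\<close>
  have "D \<le> (\<Sum>v\<in>P - S. f (insert v S) - f S)"
    unfolding D_def using submodular_marginal_le_sum[OF sub, of "P - S" S] P(1) sU
    by (metis Diff_subset Un_Diff_cancel finite_Diff order_trans sup_commute)
  also have "\<dots> \<le> (\<Sum>v\<in>P - S. \<delta>)"
  proof (intro sum_mono)
    fix v assume "v \<in> P - S"
    then have "\<not> f ({} \<union> (S \<union> {x})) < f ({} \<union> (S \<union> {v}))"
      using step.hyps(3) P(2) unfolding is_arg_max_def by blast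
    then show "f (insert v S) - f S \<le> \<delta>" unfolding \<delta>_def by simp
  qed
  finally have Dn: "D \<le> real n * \<delta>" by (simp add: n_def)
  have npos: "real n > 0" using mn by simp
  have Dd: "D / real n \<le> \<delta>" using Dn npos by (simp add: pos_divide_le_eq mult.commute)
  let ?\<phi> = "greedy_rate k"
  have "?\<phi> (Suc m') n * D \<le> \<delta> + ?\<phi> m' (card (P - insert x S)) * D'"
  proof (cases "x \<in> P")
    \<comment> \<open>Greedy uses up a competitor: \<open>D\<close> drops by all of \<delta>, but
      only \<open>n - 1\<close> competitors remain, and \<open>greedy_rate_overlap\<close>
      compensates.\<close>
    case True
    obtain n' where n': "n = Suc n'" using mn by (cases n) auto
    have card: "card (P - insert x S) = n'"
      using n' True x P(1) unfolding n_def
      by (metis Diff_insert card_Diff_singleton DiffI diff_Suc_1)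
    have D': "D' = D - \<delta>" using True unfolding D_def D'_def \<delta>_def by (simp add: insert_absorb)
    note \<phi> = greedy_rate_bounds[OF k, of m' n']
    have "m' \<le> n'" using mn n' by simp
    note ov = greedy_rate_overlap[OF k this]
    have "?\<phi> (Suc m') n * D = (1 + (real n - k) * ?\<phi> m' n) * (D / real n)"
      using npos by (simp add: greedy_rate_Suc field_simps)
    also have "\<dots> \<le> (1 + real n' * ?\<phi> m' n') * (D / real n)"
      using ov D0 npos n' by (intro mult_right_mono) auto
    also have "\<dots> = (1 - ?\<phi> m' n') * (D / real n) + ?\<phi> m' n' * D"
      using npos n' by (simp add: field_simps)
    also have "\<dots> \<le> (1 - ?\<phi> m' n') * \<delta> + ?\<phi> m' n' * D"
      using Dd \<phi> \<open>m' \<le> n'\<close> by (intro add_right_mono mult_left_mono) auto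
    also have "\<dots> = \<delta> + ?\<phi> m' n' * D'" by (simp add: D' algebra_simps)
    finally show ?thesis by (simp add: card)
  next
    \<comment> \<open>All \<open>n\<close> competitors remain, and \<open>D\<close> drops by at most
      \<open>k * \<delta>\<close>, since \<open>x\<close> keeps a marginal of at least
      \<open>(1 - k) * \<delta>\<close> on top of \<open>P \<union> S\<close>.\<close>
    case False
    have card: "card (P - insert x S) = n" using False by (simp add: n_def)
    have "m' \<le> n" using mn by simp
    note \<phi> = greedy_rate_bounds[OF k this]
    have "(1 - k) * \<delta> \<le> f (insert x (P \<union> S)) - f (P \<union> S)"
      unfolding \<delta>_def using sU False x by (intro marginal_ratioD[OF ratio]) auto
    then have D': "D - k * \<delta> \<le> D'" unfolding D_def D'_def \<delta>_def by (simp add: algebra_simps)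
    have "?\<phi> (Suc m') n * D = (1 - k * ?\<phi> m' n) * (D / real n) + ?\<phi> m' n * D"
      using npos by (simp add: greedy_rate_Suc field_simps)
    also have "\<dots> \<le> (1 - k * ?\<phi> m' n) * \<delta> + ?\<phi> m' n * D"
      using Dd \<phi> by (intro add_right_mono mult_left_mono) auto
    also have "\<dots> = \<delta> + ?\<phi> m' n * (D - k * \<delta>)" by (simp add: algebra_simps)
    also have "\<dots> \<le> \<delta> + ?\<phi> m' n * D'" using D' \<phi> by (intro add_left_mono mult_left_mono) auto
    finally show ?thesis by (simp add: card)
  qed
  then show ?case
    using step.IH unfolding D_def[symmetric] n_def[symmetric] m' 
    by (simp add: m'' \<delta>_def D'_def)
qed

lemma greedy_curvature_bound:
  assumes "greedy_state f {} Vt S1 m S" "card S = m" "nondecreasing_on U f" "submodular_on U f"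
    and "marginal_ratio U f (1 - k)" "0 \<le> k" "k \<le> 1" "f {} = 0"
    and "Vt \<subseteq> U" "finite P" "P \<subseteq> Vt - S1" "card P = m"
  shows "(if k = 0 then 1 else (1 - exp (- k)) / k) * f P \<le> f S"
proof (cases "m = 0")
  case True
  then show ?thesis using assms(2,8,10,12) greedy_state_subset[OF assms(1)] by auto
next
  case False
  have "0 \<le> f P" using assms nondecreasing_onD[OF assms(3), of "{}" P] by auto
  then have "(if k = 0 then 1 else (1 - exp (- k)) / k) * f P \<le> greedy_rate k m m * f P"
    using greedy_rate_ge_exp[of k m] False assms by (intro mult_right_mono) auto
  also have "\<dots> \<le> f S"
    using greedy_curvature_invariant[OF assms(1,3-12)] assms(2) by (simp add: greedy_rate_def)
  finally show ?thesis .
qed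

section \<open>Chaining the stages and the final bounds\<close>

text \<open>Gains are compared stage by stage and telescope. Disjointness of the stages keeps both
  prefixes \<open>K\<close> and \<open>X\<close> outside the current ground set.\<close>

lemma ram_kept_ratio:
  assumes ratio: "marginal_ratio U f q" and q: "0 \<le> q" and mono: "nondecreasing_on U f" and f0: "f {} = 0"
    and step: "\<And>t. t \<in> {1..T} \<Longrightarrow> finite (V t) \<and> V t \<subseteq> U \<and> S1 t \<subseteq> V t \<and> card (S1 t) = \<beta> t \<and>
      S2 t \<subseteq> V t - S1 t \<and> card (S2 t) = m t \<and> selected ram B t = S1 t \<union> S2 t \<and>
      greedy_state f (kept ram B (t - 1)) (V t) (S1 t) (m t) (S2 t) \<and>
      (\<forall>v\<in>S1 t. \<forall>w\<in>V t - S1 t. f {w} \<le> f {v}) \<and> B t \<subseteq> S1 t \<union> S2 t \<and> card (B t) \<le> \<beta> t \<and>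
      P t \<subseteq> V t - S1 t \<and> card (P t) = m t"
    and disj: "disjoint_family_on V {1..T}"
  shows "t \<le> T \<Longrightarrow> q ^ 3 * f (\<Union>s\<in>{1..t}. P s) \<le> f (kept ram B t)"
proof (induction t)
  case 0
  then show ?case using f0 by (simp add: kept_def)
next
  case (Suc t)
  define K X W where "K = kept ram B t" and "X = (\<Union>s\<in>{1..t}. P s)"
    and "W = S1 (Suc t) \<union> S2 (Suc t) - B (Suc t)"
  have St: "Suc t \<in> {1..T}" using Suc.prems by simp
  note s = step[OF St]
  have in_V: "P s \<subseteq> V s \<and> selected ram B s \<subseteq> V s \<and> V s \<subseteq> U \<and> V s \<inter> V (Suc t) = {}"
    if "s \<in> {1..t}" for s
    using step[of s] that disj Suc.prems unfolding disjoint_family_on_def by force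
  have K: "K \<subseteq> U - V (Suc t)" and X: "X \<subseteq> U - V (Suc t)"
    using in_V unfolding K_def X_def kept_def by blast+
  have fin: "finite (S1 (Suc t))" "finite (S2 (Suc t))" "finite (P (Suc t))" "finite (B (Suc t))"
    using s by (meson finite_subset finite_Diff finite_UnI)+
  have split: "{1..Suc t} = insert (Suc t) {1..t}" by auto
  have Un: "(\<Union>s\<in>{1..Suc t}. P s) = X \<union> P (Suc t)" "kept ram B (Suc t) = K \<union> W"
    using s unfolding split X_def K_def W_def kept_def by auto
  have W: "finite W" "W \<subseteq> V (Suc t)" using fin s by (auto simp: W_def)
  have pos: "0 \<le> f {v}" if "v \<in> S1 (Suc t)" for v
    using nondecreasing_onD[OF mono, of "{}" "{v}"] that s f0 by auto
  \<comment> \<open>Three losses, from the inside out: \<open>P\<close> against greedy, the gain of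
    \<open>S2\<close> against its singleton sum, and the singleton sum of \<open>W\<close> against
    its gain.\<close>
  have "q ^ 3 * (f (X \<union> P (Suc t)) - f X) = q * (q * (q * (f (X \<union> P (Suc t)) - f X)))"
    by (simp add: power3_eq_cube)
  also have "\<dots> \<le> q * (q * (f (K \<union> S2 (Suc t)) - f K))"
    using s K X fin ratio q unfolding K_def
    by (intro mult_left_mono greedy_marginal_ratio[where P = "P (Suc t)"]) auto
  also have "\<dots> \<le> q * (\<Sum>v\<in>S2 (Suc t). f {v})"
    using s K fin f0 q by (intro mult_left_mono marginal_sum_bounds[OF ratio]) auto
  also have "\<dots> \<le> q * (\<Sum>v\<in>W. f {v})"
    unfolding W_def using s fin pos q by (intro mult_left_mono sum_singletons_after_removal) auto
  also have "\<dots> \<le> f (K \<union> W) - f K"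
    using s K W f0 by (intro marginal_sum_bounds[OF ratio]) auto
  finally have "q ^ 3 * (f (X \<union> P (Suc t)) - f X) \<le> f (K \<union> W) - f K" .
  moreover have "q ^ 3 * f X \<le> f K" using Suc unfolding K_def X_def by simp
  ultimately show ?case unfolding Un by (simp add: algebra_simps)
qed

theorem theorem10:
  fixes T :: nat and V :: "nat \<Rightarrow> 'a set" and f :: "'a set \<Rightarrow> real"
    and \<alpha> \<beta> :: "nat \<Rightarrow> nat"
    and ram :: "'a set list \<Rightarrow> 'a set" and Bstar :: "nat \<Rightarrow> 'a set"
  defines "U \<equiv> (\<Union>t\<in>{1..T}. V t)"
  defines "fstar \<equiv> rsm_optimum T V f \<alpha> \<beta>"
  defines "\<kappa> \<equiv> curvature U f"
  defines "c \<equiv> total_curvature U f"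
  assumes "T \<ge> 1"
    and "\<And>t. t \<in> {1..T} \<Longrightarrow> finite (V t)"
    and "disjoint_family_on V {1..T}"
    and "nondecreasing_on U f"
    and "f {} = 0"
    and "\<And>t. t \<in> {1..T} \<Longrightarrow> \<beta> t \<le> \<alpha> t \<and> \<alpha> t \<le> card (V t)"
    and "ram_rule T V f \<alpha> \<beta> ram"
    and "optimal_removal T f \<beta> ram Bstar"
  shows "(\<forall>t\<in>{1..T}. card (selected ram Bstar t) \<le> \<alpha> t) \<and>
    (submodular_on U f \<and> (\<forall>v\<in>U. f {v} \<noteq> 0) \<and> fstar > 0 \<longrightarrow>
       f (kept ram Bstar T) / fstar \<ge>
         (if T = 1 then (if \<kappa> = 0 then 1 else (1 - exp (- \<kappa>)) / \<kappa>) * (1 - \<kappa>)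
          else (1 - \<kappa>) ^ 4)) \<and>
    (fstar > 0 \<longrightarrow>
       f (kept ram Bstar T) / fstar \<ge> (if T = 1 then (1 - c) ^ 3 else (1 - c) ^ 5))"
proof -
  note T = assms(5) and fin = assms(6) and disj = assms(7) and mono = assms(8) and f0 = assms(9)
    and bounds = assms(10) and rule = assms(11) and opt = assms(12)
  have rem: "removal T \<beta> ram Bstar" using opt by (simp add: optimal_removal_def is_arg_min_def)
  have "\<exists>S1 S2. S1 \<subseteq> V t \<and> card S1 = \<beta> t \<and> S2 \<subseteq> V t - S1 \<and> card S2 = \<alpha> t - \<beta> t \<and>
      selected ram Bstar t = S1 \<union> S2 \<and>
      greedy_state f (kept ram Bstar (t - 1)) (V t) S1 (\<alpha> t - \<beta> t) S2 \<and>
      (\<forall>v\<in>S1. \<forall>w\<in>V t - S1. f {w} \<le> f {v})" if t: "t \<in> {1..T}" for t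
  proof -
    \<comment> \<open>Prefixes of an admissible removal are admissible, so the rule applies at every
      stage along \<open>Bstar\<close>.\<close>
    have "removal (t - 1) \<beta> ram Bstar" using rem t unfolding removal_def by auto
    then have "ram_output f (V t) (\<alpha> t) (\<beta> t) (kept ram Bstar (t - 1)) (selected ram Bstar t)"
      using rule t unfolding ram_rule_def by blast
    from ram_outputE[OF this] bounds[OF t] obtain S1 S2 where
      "selected ram Bstar t = S1 \<union> S2" "S1 \<subseteq> V t" "card S1 = \<beta> t" "S2 \<subseteq> V t - S1"
      "card S2 = \<alpha> t - \<beta> t" "greedy_state f (kept ram Bstar (t - 1)) (V t) S1 (\<alpha> t - \<beta> t) S2"
      "\<And>v w. v \<in> S1 \<Longrightarrow> w \<in> V t - S1 \<Longrightarrow> f {w} \<le> f {v}"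
      by metis
    then show ?thesis by (intro exI[of _ S1] exI[of _ S2] conjI ballI)
  qed
  then obtain S1 S2 where S: "\<And>t. t \<in> {1..T} \<Longrightarrow> S1 t \<subseteq> V t \<and> card (S1 t) = \<beta> t \<and>
      S2 t \<subseteq> V t - S1 t \<and> card (S2 t) = \<alpha> t - \<beta> t \<and> selected ram Bstar t = S1 t \<union> S2 t \<and>
      greedy_state f (kept ram Bstar (t - 1)) (V t) (S1 t) (\<alpha> t - \<beta> t) (S2 t) \<and>
      (\<forall>v\<in>S1 t. \<forall>w\<in>V t - S1 t. f {w} \<le> f {v})"
    by metis
  have "card (selected ram Bstar t) \<le> \<alpha> t" if "t \<in> {1..T}" for t
    using S[OF that] bounds[OF that] card_Un_le[of "S1 t" "S2 t"] by simp
  moreover have finU: "finite U" using fin by (auto simp: U_def)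
  have VU: "V t \<subseteq> U" if "t \<in> {1..T}" for t using that by (auto simp: U_def)
  have finS1: "finite (S1 t)" if "t \<in> {1..T}" for t
    using S[OF that] fin[OF that] finite_subset by blast
  \<comment> \<open>The adversary's target \<open>C\<close> is RAM's own \<open>S1\<close>, of size
    \<beta>; so \<open>P\<close> competes in the pool from which the greedy loop selects.\<close>
  have "{1..<1 + T} = {1..T}" by auto
  then have "\<exists>P. (\<forall>s\<in>{1..T}. P s \<subseteq> V s - S1 s \<and> card (P s) = \<alpha> s - \<beta> s) \<and>
      rsm_value f V \<alpha> \<beta> T 1 {} \<le> f ({} \<union> (\<Union>s\<in>{1..T}. P s))"
    using rsm_value_upper_bound[of 1 T V S1 \<beta> \<alpha> f "{}"] S fin finS1 bounds by simp
  then obtain P where P: "\<And>s. s \<in> {1..T} \<Longrightarrow> P s \<subseteq> V s - S1 s \<and> card (P s) = \<alpha> s - \<beta> s"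
    and fP: "fstar \<le> f (\<Union>s\<in>{1..T}. P s)"
    unfolding fstar_def rsm_optimum_def by (metis sup_bot_left)
  have PU: "(\<Union>s\<in>{1..T}. P s) \<subseteq> U" using P VU by blast
  have B: "Bstar t \<subseteq> S1 t \<union> S2 t \<and> card (Bstar t) \<le> \<beta> t" if "t \<in> {1..T}" for t
    using rem S that unfolding removal_def by auto
  have cube: "q ^ 3 * fstar \<le> f (kept ram Bstar T)" if "marginal_ratio U f q" "0 \<le> q" for q
  proof -
    have "q ^ 3 * fstar \<le> q ^ 3 * f (\<Union>s\<in>{1..T}. P s)" using fP that by (intro mult_left_mono) auto
    also have "\<dots> \<le> f (kept ram Bstar T)"
      using S fin P B VU
      by (intro ram_kept_ratio[OF that mono f0 _ disj, where ?S1.0 = S1 and ?S2.0 = S2 and \<beta> = \<beta>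
            and m = "\<lambda>t. \<alpha> t - \<beta> t"]) simp_all
    finally show ?thesis .
  qed
  moreover have "f (kept ram Bstar T) / fstar \<ge>
         (if T = 1 then (if \<kappa> = 0 then 1 else (1 - exp (- \<kappa>)) / \<kappa>) * (1 - \<kappa>)
          else (1 - \<kappa>) ^ 4)"
    if sub: "submodular_on U f" and nz: "\<forall>v\<in>U. f {v} \<noteq> 0" and pos: "fstar > 0"
  proof -
    \<comment> \<open>A positive optimum rules out an empty ground set, so the \<open>Min\<close> in
      the curvature is meaningful.\<close>
    have "U \<noteq> {}" using PU fP pos f0 by force
    note \<kappa> = marginal_ratio_curvature[OF finU this mono f0 sub nz, folded \<kappa>_def]
    show ?thesis
    proof (cases "T = 1")
      case False
      have "(1 - \<kappa>) ^ 4 \<le> (1 - \<kappa>) ^ 3" using \<kappa> by (intro power_decreasing) auto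
      also have "\<dots> \<le> f (kept ram Bstar T) / fstar" using cube[of "1 - \<kappa>"] \<kappa> pos by (simp add: pos_le_divide_eq)
      finally show ?thesis using False by simp
    next
      case True
      define r where "r = (if \<kappa> = 0 then 1 else (1 - exp (- \<kappa>)) / \<kappa>)"
      have "1 \<in> {1..T}" using T by simp
      note one = S[OF this] B[OF this] P[OF this] VU[OF this] fin[OF this] finS1[OF this]
      \<comment> \<open>Nothing is kept before stage 1, so the loop maximizes \<open>f\<close> from
        the empty set, as \<open>greedy_curvature_bound\<close> requires.\<close>
      have kept: "kept ram Bstar 0 = {}" "kept ram Bstar T = S1 1 \<union> S2 1 - Bstar 1"
        using one True by (auto simp: kept_def)
      have f2: "finite (S2 1)" "finite (P 1)" using one by (meson finite_subset finite_Diff)+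
      have sub2: "S2 1 \<subseteq> U" using one by blast
      have f3: "finite (Bstar 1)" using one f2 by (meson finite_subset finite_UnI)
      have nonneg: "0 \<le> f {v}" if "v \<in> S1 1" for v
        using nondecreasing_onD[OF mono, of "{}" "{v}"] that one f0 by auto
      have "0 \<le> r" using \<kappa> by (simp add: r_def)
      then have "r * fstar \<le> r * f (P 1)" using fP True by (intro mult_left_mono) auto
      also have "\<dots> \<le> f (S2 1)"
        unfolding r_def using one kept(1) mono sub \<kappa> f0 f2
        by (intro greedy_curvature_bound[where Vt = "V 1" and ?S1.0 = "S1 1" and U = U]) auto
      also have "\<dots> \<le> (\<Sum>v\<in>S2 1. f {v})"
        using submodular_marginal_le_sum[OF sub f2(1) sub2, of "{}"] f0 by simp
      also have "\<dots> \<le> (\<Sum>v\<in>S1 1 \<union> S2 1 - Bstar 1. f {v})"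
        using one f2 f3 nonneg by (intro sum_singletons_after_removal) auto
      finally have "(1 - \<kappa>) * (r * fstar) \<le> (1 - \<kappa>) * (\<Sum>v\<in>S1 1 \<union> S2 1 - Bstar 1. f {v})"
        using \<kappa> by (intro mult_left_mono) auto
      also have "\<dots> \<le> f (kept ram Bstar T)"
        using marginal_sum_bounds(1)[OF \<kappa>(1) f0, of "S1 1 \<union> S2 1 - Bstar 1" "{}"] one f2 sub2 f0
        unfolding kept by force
      finally have "r * (1 - \<kappa>) \<le> f (kept ram Bstar T) / fstar"
        using pos by (simp add: pos_le_divide_eq mult_ac)
      then show ?thesis using True by (simp add: r_def)
    qed
  qed
  moreover have "f (kept ram Bstar T) / fstar \<ge> (if T = 1 then (1 - c) ^ 3 else (1 - c) ^ 5)"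
    if pos: "fstar > 0"
  proof -
    \<comment> \<open>A positive optimum makes \<open>f\<close> nonconstant, so the total curvature
      has a ratio to minimize over.\<close>
    have "f (\<Union>s\<in>{1..T}. P s) \<noteq> f {}" using fP pos f0 by simp
    note c = marginal_ratio_total_curvature[OF finU mono PU this, folded c_def]
    have "(1 - c) ^ 5 \<le> (1 - c) ^ 3" using c by (intro power_decreasing) auto
    moreover have "(1 - c) ^ 3 \<le> f (kept ram Bstar T) / fstar"
      using cube[of "1 - c"] c pos by (simp add: pos_le_divide_eq)
    ultimately show ?thesis by (smt (verit))
  qed
  ultimately show ?thesis by blast
qed

end
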